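(* Let $G=(\mathcal V,\mathcal E)$ be a locally finite weighted graph with vertex weights $m_0$ and edge weights $m_1$, let $L(G)$ be its line graph, and assume $\Delta(L(G))=\sup_{e\in\mathcal E}\deg_{L(G)}(e)<\infty$. Assume there are constants with $0<c_0\le m_0(x)\le C_0<\infty$ for all $x\in\mathcal V$ and $0<c_1\le m_1(x,y)\le C_1<\infty$ for all $x\sim y$. Then the top-degree Hodge Laplacian $\Delta_1$ on the core $\mathcal C^1_c$ satisfies $$\|\Delta_1\|\le\frac{C_1}{c_0}\bigl(\Delta(L(G))+2\bigr)$$ and extends uniquely to a bounded self-adjoint operator on $\ell^2(\mathcal E,m_1)$. The same bound holds for $\widetilde\Delta_1$.
   Context: Weighted graph: $\mathcal V$ countable, $m_0:\mathcal V\to(0,\infty)$, $m_1:\mathcal V^2\to[0,\infty)$ symmetric and vanishing on the diagonal; $x\sim y$ iff $m_1(x,y)>0$, and $\mathcal E$ is the set of unordered pairs of adjacent vertices. Locally finite: each vertex has finitely many neighbors. The line graph $L(G)$ has vertex set $\mathcal E$, two distinct edges being adjacent iff they share an endpoint. The graph is regarded as a $1$-dimensional complex. A $1$-cochain is a function $f$ on oriented edges with $f([y,x])=-f([x,y])$; $\mathcal C^1_c$ denotes the finitely supported ones; $\ell^2(\mathcal E,m_1)$ is the space of $1$-cochains with $\|f\|^2=\sum_{\{x,y\}\in\mathcal E}m_1(x,y)|f([x,y])|^2<\infty$. $(d^1u)([x,y])=u(y)-u(x)$; $(\delta^1f)(x)=\frac1{m_0(x)}\sum_{y\sim x}m_1(x,y)f([y,x])$;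 $\Delta_1=d^1\delta^1$. The normalized block is $\widetilde\Delta_1=M_1^{1/2}\Delta_1M_1^{-1/2}$, acting on the unweighted $\ell^2$ space of $1$-cochains (weight $1$ in place of $m_1$), where $M_1$ is multiplication by $m_1$. *)

theory Defs
  imports "HOL-Analysis.Analysis"
begin

record 'v wgraph =
  verts :: "'v set"
  vwt :: "'v \<Rightarrow> real"
  ewt :: "'v \<Rightarrow> 'v \<Rightarrow> real"

text \<open>Only the values of \<open>vwt\<close> on \<open>verts\<close> and of \<open>ewt\<close> on pairs from \<open>verts\<close> are meaningful.\<close>

definition weighted_graph :: "'v wgraph \<Rightarrow> bool" where
  "weighted_graph G \<longleftrightarrow>
     countable (verts G) \<and>
     (\<forall>x\<in>verts G. 0 < vwt G x) \<and>
     (\<forall>x\<in>verts G. \<forall>y\<in>verts G. 0 \<le> ewt G x y \<and> ewt G x y = ewt G y x) \<and>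
     (\<forall>x\<in>verts G. ewt G x x = 0)"

definition adj :: "'v wgraph \<Rightarrow> 'v \<Rightarrow> 'v \<Rightarrow> bool" where
  "adj G x y \<longleftrightarrow> x \<in> verts G \<and> y \<in> verts G \<and> 0 < ewt G x y"

definition locally_finite :: "'v wgraph \<Rightarrow> bool" where
  "locally_finite G \<longleftrightarrow> (\<forall>x\<in>verts G. finite {y. adj G x y})"

definition edges :: "'v wgraph \<Rightarrow> 'v set set" where
  "edges G = {{x, y} | x y. adj G x y}"

definition line_adj :: "'v wgraph \<Rightarrow> 'v set \<Rightarrow> 'v set \<Rightarrow> bool" where
  "line_adj G e e' \<longleftrightarrow> e \<in> edges G \<and> e' \<in> edges G \<and> e \<noteq> e' \<and> e \<inter> e' \<noteq> {}"

text \<open>For a locally finite graph the line graph is locally finite, so \<open>card\<close> below is the true degree.\<close>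

definition line_deg :: "'v wgraph \<Rightarrow> 'v set \<Rightarrow> nat" where
  "line_deg G e = card {e'. line_adj G e e'}"

definition line_max_deg :: "'v wgraph \<Rightarrow> enat" where
  "line_max_deg G = (SUP e\<in>edges G. enat (line_deg G e))"

text \<open>The value \<open>f x y\<close> stands for \<open>f([x,y])\<close>. Off the oriented edges a cochain is set to \<open>0\<close>,
  so that equality of functions is equality of cochains.\<close>

definition cochains :: "'v wgraph \<Rightarrow> ('v \<Rightarrow> 'v \<Rightarrow> complex) set" where
  "cochains G = {f. (\<forall>x y. f y x = - f x y) \<and> (\<forall>x y. \<not> adj G x y \<longrightarrow> f x y = 0)}"

definition cochains_c :: "'v wgraph \<Rightarrow> ('v \<Rightarrow> 'v \<Rightarrow> complex) set" where
  "cochains_c G = {f \<in> cochains G. finite {(x, y). f x y \<noteq> 0}}"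

text \<open>The value at an unordered edge of a function on oriented edges which does not depend on the
  orientation; this allows sums over \<open>edges G\<close>, in which every edge is counted once.\<close>

definition edge_value :: "('v \<Rightarrow> 'v \<Rightarrow> 'b) \<Rightarrow> 'v set \<Rightarrow> 'b" where
  "edge_value g e = (THE r. \<exists>x y. e = {x, y} \<and> r = g x y)"

lemma edge_value_pair:
  assumes "g x y = g y x"
  shows "edge_value g {x, y} = g x y"
  unfolding edge_value_def
  by (rule the_equality) (use assms in \<open>auto simp: doubleton_eq_iff\<close>)

text \<open>The edge weight \<open>w\<close> is a parameter: \<open>ewt G\<close> gives the space \<open>\<ell>\<^sup>2(E, m\<^sub>1)\<close>, and the constant
  \<open>1\<close> the unweighted space.\<close>

definition l2 :: "'v wgraph \<Rightarrow> ('v \<Rightarrow> 'v \<Rightarrow> real) \<Rightarrow> ('v \<Rightarrow> 'v \<Rightarrow> complex) set" where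
  "l2 G w = {f \<in> cochains G.
     edge_value (\<lambda>x y. w x y * (cmod (f x y))\<^sup>2) summable_on edges G}"

definition l2_norm :: "'v wgraph \<Rightarrow> ('v \<Rightarrow> 'v \<Rightarrow> real) \<Rightarrow> ('v \<Rightarrow> 'v \<Rightarrow> complex) \<Rightarrow> real" where
  "l2_norm G w f = sqrt (\<Sum>\<^sub>\<infinity>e\<in>edges G. edge_value (\<lambda>x y. w x y * (cmod (f x y))\<^sup>2) e)"

definition l2_inner ::
  "'v wgraph \<Rightarrow> ('v \<Rightarrow> 'v \<Rightarrow> real) \<Rightarrow> ('v \<Rightarrow> 'v \<Rightarrow> complex) \<Rightarrow> ('v \<Rightarrow> 'v \<Rightarrow> complex) \<Rightarrow> complex" where
  "l2_inner G w f g =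
     (\<Sum>\<^sub>\<infinity>e\<in>edges G. edge_value (\<lambda>x y. of_real (w x y) * f x y * cnj (g x y)) e)"

type_synonym 'v cochain_op = "('v \<Rightarrow> 'v \<Rightarrow> complex) \<Rightarrow> 'v \<Rightarrow> 'v \<Rightarrow> complex"

text \<open>Norm of an operator \<open>A\<close> with domain \<open>D\<close>, a subspace of \<open>l2 G w\<close>. It is infinite if \<open>A\<close> is
  unbounded on \<open>D\<close> or does not map the unit ball of \<open>D\<close> into \<open>l2 G w\<close>.\<close>

definition operator_norm ::
  "'v wgraph \<Rightarrow> ('v \<Rightarrow> 'v \<Rightarrow> real) \<Rightarrow> ('v \<Rightarrow> 'v \<Rightarrow> complex) set \<Rightarrow> 'v cochain_op \<Rightarrow> ennreal" where
  "operator_norm G w D A =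
     (SUP f\<in>{f \<in> D. l2_norm G w f \<le> 1}. if A f \<in> l2 G w then ennreal (l2_norm G w (A f)) else top)"

definition bounded_operator :: "'v wgraph \<Rightarrow> ('v \<Rightarrow> 'v \<Rightarrow> real) \<Rightarrow> 'v cochain_op \<Rightarrow> bool" where
  "bounded_operator G w A \<longleftrightarrow>
     (\<forall>f\<in>l2 G w. A f \<in> l2 G w) \<and>
     (\<forall>f\<in>l2 G w. \<forall>g\<in>l2 G w. A (\<lambda>x y. f x y + g x y) = (\<lambda>x y. A f x y + A g x y)) \<and>
     (\<forall>c. \<forall>f\<in>l2 G w. A (\<lambda>x y. c * f x y) = (\<lambda>x y. c * A f x y)) \<and>
     operator_norm G w (l2 G w) A < top"

text \<open>Used for everywhere defined bounded operators only, so there is no question of domains.\<close>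

definition self_adjoint :: "'v wgraph \<Rightarrow> ('v \<Rightarrow> 'v \<Rightarrow> real) \<Rightarrow> 'v cochain_op \<Rightarrow> bool" where
  "self_adjoint G w A \<longleftrightarrow>
     (\<forall>f\<in>l2 G w. \<forall>g\<in>l2 G w. l2_inner G w (A f) g = l2_inner G w f (A g))"

definition d1 :: "'v wgraph \<Rightarrow> ('v \<Rightarrow> complex) \<Rightarrow> 'v \<Rightarrow> 'v \<Rightarrow> complex" where
  "d1 G u x y = (if adj G x y then u y - u x else 0)"

definition delta1 :: "'v wgraph \<Rightarrow> ('v \<Rightarrow> 'v \<Rightarrow> complex) \<Rightarrow> 'v \<Rightarrow> complex" where
  "delta1 G f x = of_real (1 / vwt G x) * (\<Sum>y | adj G x y. of_real (ewt G x y) * f y x)"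

definition Laplace1 :: "'v wgraph \<Rightarrow> 'v cochain_op" where
  "Laplace1 G f = d1 G (delta1 G f)"

text \<open>The power \<open>M\<^sub>1\<^sup>s\<close> of the operator of multiplication by the edge weight.\<close>

definition M1_pow :: "'v wgraph \<Rightarrow> real \<Rightarrow> 'v cochain_op" where
  "M1_pow G s f x y = of_real (ewt G x y powr s) * f x y"

definition normalized_Laplace1 :: "'v wgraph \<Rightarrow> 'v cochain_op" where
  "normalized_Laplace1 G f = M1_pow G (1/2) (Laplace1 G (M1_pow G (-1/2) f))"

end

theory Submission
  imports Defs
begin

text \<open>
  Write \<open>d\<close> for the coboundary \<open>d1\<close> and \<open>\<delta>\<close> for \<open>delta1\<close>, so that \<open>\<Delta>\<^sub>1 = d \<delta>\<close>, and put
  \<open>K = C\<^sub>1 (\<Delta>(L(G)) + 2) / c\<^sub>0\<close>. The proof shows that both factors have squared norm at most \<open>K\<close>,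
  as operators between the weighted \<open>\<ell>\<^sup>2\<close> spaces of functions on vertices and of cochains.

  The geometric input is that an edge \<open>{x, y}\<close> has at least \<open>deg x + deg y - 2\<close> neighbours in the
  line graph (\<open>degree_sum_le_line_deg\<close>), so \<open>deg x + deg y \<le> \<Delta>(L(G)) + 2\<close> for adjacent vertices.
  For \<open>\<delta>\<close>, the Cauchy-Schwarz inequality at a vertex \<open>x\<close> costs a factor \<open>deg x\<close>; after
  summation over \<open>x\<close> every edge carries the factor \<open>deg x + deg y\<close> (\<open>delta1_bounded\<close>). For \<open>d\<close>, the
  crude estimate \<open>|b - a|\<^sup>2 \<le> 2 (|a|\<^sup>2 + |b|\<^sup>2)\<close> would give twice the maximal degree, which can exceed
  the claimed constant; it is replaced by
  \<open>|b - a|\<^sup>2 \<le> (deg x + deg y) (|a|\<^sup>2 / deg x + |b|\<^sup>2 / deg y)\<close> with \<open>a = u x\<close> and \<open>b = u y\<close>, whose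
  denominators cancel when the sum is taken over the edges at a vertex (\<open>d1_bounded\<close>).

  By local finiteness the formula for \<open>\<Delta>\<^sub>1\<close> makes sense for every cochain, and by these bounds it
  defines a bounded operator on the whole \<open>\<ell>\<^sup>2\<close> space. This operator is the extension. It is
  self-adjoint because \<open>d\<close> and \<open>\<delta>\<close> are adjoint to each other (\<open>d1_adjoint_delta1\<close>), which turns
  \<open>\<langle>\<Delta>\<^sub>1 f, g\<rangle>\<close> into \<open>\<langle>\<delta> f, \<delta> g\<rangle>\<close>. It is the only extension because every cochain is approximated in norm by its
  restrictions to finite sets of edges (\<open>bounded_operator_unique\<close>). The normalized Laplacian is the
  conjugate of \<open>\<Delta>\<^sub>1\<close> by an isometry from the unweighted to the weighted space
  (\<open>M1_pow_isometry\<close>), and so it has the same bound.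

  In these estimates, a sum over edges is written as half of a sum over oriented edges
  (\<open>darts_edges\<close>), which in turn splits into sums over the neighbours of each vertex.
\<close>

section \<open>Oriented edges and degrees\<close>

definition nbrs :: "'v wgraph \<Rightarrow> 'v \<Rightarrow> 'v set" where
  "nbrs G x = {y. adj G x y}"

definition degree :: "'v wgraph \<Rightarrow> 'v \<Rightarrow> nat" where
  "degree G x = card (nbrs G x)"

definition darts :: "'v wgraph \<Rightarrow> ('v \<times> 'v) set" where
  "darts G = {(x, y). adj G x y}"

text \<open>The weights considered for cochains, namely \<open>m\<^sub>1\<close> and \<open>1\<close>. Symmetry makes the energy
  density of a cochain a function on unoriented edges, and positivity lets the norm control values.\<close>

definition edge_weight :: "'v wgraph \<Rightarrow> ('v \<Rightarrow> 'v \<Rightarrow> real) \<Rightarrow> bool" where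
  "edge_weight G w \<longleftrightarrow> (\<forall>x y. adj G x y \<longrightarrow> 0 < w x y \<and> w x y = w y x)"

lemma darts_eq_Sigma: "darts G = Sigma (verts G) (nbrs G)"
  by (auto simp: darts_def nbrs_def adj_def)

lemma edge_weight_nonneg: "edge_weight G w \<Longrightarrow> adj G x y \<Longrightarrow> 0 \<le> w x y"
  by (simp add: edge_weight_def less_imp_le)

lemma edge_weight_one: "edge_weight G (\<lambda>_ _. 1)"
  by (simp add: edge_weight_def)

locale loc_fin_graph =
  fixes G :: "'v wgraph"
  assumes weighted: "weighted_graph G" and loc_fin: "locally_finite G"
begin

lemma adj_sym: "adj G x y \<longleftrightarrow> adj G y x"
  using weighted by (auto simp: adj_def weighted_graph_def)

lemma adj_irrefl: "\<not> adj G x x"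
  using weighted by (auto simp: adj_def weighted_graph_def)

lemma ewt_sym: "adj G x y \<Longrightarrow> ewt G y x = ewt G x y"
  using weighted by (auto simp: adj_def weighted_graph_def)

lemma edge_weight_ewt: "edge_weight G (ewt G)"
  using ewt_sym by (auto simp: edge_weight_def adj_def)

lemma vwt_pos: "x \<in> verts G \<Longrightarrow> 0 < vwt G x"
  using weighted by (auto simp: weighted_graph_def)

lemma finite_nbrs: "finite (nbrs G x)"
  using loc_fin by (cases "x \<in> verts G") (auto simp: nbrs_def locally_finite_def adj_def)

lemma degree_pos: "adj G x y \<Longrightarrow> 0 < degree G x"
  using finite_nbrs by (auto simp: degree_def card_gt_0_iff nbrs_def)

lemma bij_swap_darts: "bij_betw prod.swap (darts G) (darts G)"
  by (rule bij_betwI[of _ _ _ prod.swap]) (auto simp: darts_def adj_sym)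

lemma summable_darts_swap:
  "(\<lambda>(x, y). g y x) summable_on darts G \<longleftrightarrow> (\<lambda>(x, y). g x y) summable_on darts G"
  using summable_on_reindex_bij_betw[OF bij_swap_darts, of "\<lambda>(x, y). g x y"]
  by (simp add: case_prod_unfold)

lemma infsum_darts_swap:
  "infsum (\<lambda>(x, y). g y x) (darts G) = infsum (\<lambda>(x, y). g x y) (darts G)"
  using infsum_reindex_bij_betw[OF bij_swap_darts, of "\<lambda>(x, y). g x y"]
  by (simp add: case_prod_unfold)

lemma edgesE:
  assumes "e \<in> edges G"
  obtains x y where "adj G x y" "e = {x, y}"
  using assms by (auto simp: edges_def)

lemma edgesI: "adj G x y \<Longrightarrow> {x, y} \<in> edges G"
  unfolding edges_def by blast

text \<open>A choice of one orientation for every edge splits the oriented edges into two disjoint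
  copies of the set of edges, which reversal exchanges; disjointness holds as there are no loops.\<close>

lemma darts_edges:
  fixes g :: "'v \<Rightarrow> 'v \<Rightarrow> 'b::banach"
  assumes sym: "\<And>x y. adj G x y \<Longrightarrow> g x y = g y x"
  shows summable_darts_iff:
      "(\<lambda>(x, y). g x y) summable_on darts G \<longleftrightarrow> edge_value g summable_on edges G"
    and infsum_darts_eq:
      "infsum (\<lambda>(x, y). g x y) (darts G)
        = infsum (edge_value g) (edges G) + infsum (edge_value g) (edges G)"
proof -
  let ?g = "\<lambda>(x, y). g x y" and ?v = "edge_value g"
  have "\<forall>e\<in>edges G. \<exists>p. p \<in> darts G \<and> e = {fst p, snd p}"
    by (auto simp: edges_def darts_def)
  then obtain s where s: "\<And>e. e \<in> edges G \<Longrightarrow> s e \<in> darts G"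
    and ends: "\<And>e. e \<in> edges G \<Longrightarrow> {fst (s e), snd (s e)} = e"
    by metis
  \<comment> \<open>The chosen orientations, and below their reversals.\<close>
  define P where "P = s ` edges G"
  define Q where "Q = prod.swap ` P"
  have inj: "inj_on s (edges G)"
    by (rule inj_onI) (metis ends)
  have injs: "inj_on (prod.swap \<circ> s) (edges G)"
    by (rule comp_inj_on[OF inj]) (metis inj_onI swap_swap)
  have Q: "Q = (prod.swap \<circ> s) ` edges G"
    by (simp add: Q_def P_def image_comp)
  have val: "g (fst (s e)) (snd (s e)) = ?v e" "g (snd (s e)) (fst (s e)) = ?v e"
    if "e \<in> edges G" for e
  proof -
    from s[OF that] have a: "adj G (fst (s e)) (snd (s e))"
      by (auto simp: darts_def)
    show "g (fst (s e)) (snd (s e)) = ?v e"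
      using edge_value_pair[of g, OF sym[OF a]] ends[OF that] by simp
    then show "g (snd (s e)) (fst (s e)) = ?v e"
      using sym[OF a] by simp
  qed
  have hs: "(?g has_sum I) P \<longleftrightarrow> (?v has_sum I) (edges G)"
    "(?g has_sum I) Q \<longleftrightarrow> (?v has_sum I) (edges G)" for I
    unfolding Q P_def has_sum_reindex[OF inj] has_sum_reindex[OF injs]
    by (rule has_sum_cong; simp add: case_prod_unfold val)+
  have PQ: "P \<inter> Q = {}"
  proof -
    have "s e \<noteq> prod.swap (s e')" if "e \<in> edges G" "e' \<in> edges G" for e e'
    proof
      assume sw: "s e = prod.swap (s e')"
      have "{fst (s e), snd (s e)} = {fst (s e'), snd (s e')}"
        unfolding sw by auto
      then have "e = e'"
        using ends[OF that(1)] ends[OF that(2)] by simp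
      then have "fst (s e) = snd (s e)"
        using sw by (metis fst_swap)
      then show False
        using s[OF that(1)] adj_irrefl by (auto simp: darts_def)
    qed
    then show ?thesis
      unfolding P_def Q_def by blast
  qed
  have U: "P \<union> Q = darts G"
  proof
    have "P \<subseteq> darts G"
      using s by (auto simp: P_def)
    moreover from this have "Q \<subseteq> darts G"
      using image_mono[of P "darts G" prod.swap] bij_betw_imp_surj_on[OF bij_swap_darts]
      by (simp only: Q_def)
    ultimately show "P \<union> Q \<subseteq> darts G" by blast
  next
    show "darts G \<subseteq> P \<union> Q"
    proof
      fix p assume p: "p \<in> darts G"
      define e where "e = {fst p, snd p}"
      have e: "e \<in> edges G"
        using p edgesI unfolding darts_def e_def by force
      have "p = s e \<or> p = prod.swap (s e)"
        using ends[OF e] unfolding e_def doubleton_eq_iff prod_eq_iff by auto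
      then show "p \<in> P \<union> Q"
        using e unfolding P_def Q_def by blast
    qed
  qed
  have both: "(?g has_sum I + I) (darts G)" if "(?v has_sum I) (edges G)" for I
    using has_sum_Un_disjoint[of ?g P I Q I] that PQ U hs by auto
  show iff: "?g summable_on darts G \<longleftrightarrow> ?v summable_on edges G"
  proof
    assume "?g summable_on darts G"
    then have "?g summable_on P"
      by (rule summable_on_subset_banach) (use U in auto)
    then show "?v summable_on edges G"
      using hs by (auto simp: summable_on_def)
  next
    assume "?v summable_on edges G"
    then show "?g summable_on darts G"
      using both by (meson has_sum_infsum has_sum_imp_summable)
  qed
  show "infsum ?g (darts G) = infsum ?v (edges G) + infsum ?v (edges G)"
  proof (cases "?v summable_on edges G")
    case True
    then show ?thesis
      using both[OF has_sum_infsum[OF True]] infsumI by blast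
  next
    case False
    then show ?thesis
      using iff by (simp add: infsum_not_exists)
  qed
qed

text \<open>For nonnegative terms, summability can be tested on the sums at the vertices, because
  the inner sums are finite.\<close>

lemma summable_darts_iff_verts:
  fixes g :: "'v \<Rightarrow> 'v \<Rightarrow> real"
  assumes nonneg: "\<And>x y. adj G x y \<Longrightarrow> 0 \<le> g x y"
  shows "(\<lambda>(x, y). g x y) summable_on darts G
    \<longleftrightarrow> (\<lambda>x. \<Sum>y\<in>nbrs G x. g x y) summable_on verts G" (is "?L \<longleftrightarrow> ?R")
proof
  assume ?L
  then have "((\<lambda>(x, y). g x y) has_sum infsum (\<lambda>(x, y). g x y) (darts G)) (Sigma (verts G) (nbrs G))"
    by (simp add: darts_eq_Sigma)
  then have "((\<lambda>x. \<Sum>y\<in>nbrs G x. g x y) has_sum infsum (\<lambda>(x, y). g x y) (darts G)) (verts G)"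
    by (rule has_sum_SigmaD) (use has_sum_finite[OF finite_nbrs] in simp)
  then show ?R
    by (rule has_sum_imp_summable)
next
  assume R: ?R
  show ?L
    unfolding darts_eq_Sigma
  proof (rule summable_on_SigmaI[OF _ R])
    show "((\<lambda>y. case (x, y) of (x, y) \<Rightarrow> g x y) has_sum (\<Sum>y\<in>nbrs G x. g x y)) (nbrs G x)" for x
      using has_sum_finite[OF finite_nbrs] by simp
  qed (use nonneg in \<open>auto simp: nbrs_def\<close>)
qed

lemma infsum_darts_verts:
  fixes g :: "'v \<Rightarrow> 'v \<Rightarrow> 'b::banach"
  assumes "(\<lambda>(x, y). g x y) summable_on darts G"
  shows "infsum (\<lambda>(x, y). g x y) (darts G) = infsum (\<lambda>x. \<Sum>y\<in>nbrs G x. g x y) (verts G)"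
  using infsum_Sigma_banach[of "\<lambda>(x, y). g x y" "verts G" "nbrs G"] assms finite_nbrs
  by (simp add: darts_eq_Sigma)

text \<open>The \<open>deg x - 1\<close> other edges at \<open>x\<close> and the \<open>deg y - 1\<close> other edges at \<open>y\<close> are
  distinct neighbours of \<open>{x, y}\<close> in the line graph: an edge in both families would join \<open>x\<close> and
  \<open>y\<close>. Line degrees are cardinalities, so their finiteness enters as well.\<close>

lemma degree_sum_le_line_deg:
  assumes a: "adj G x y"
  shows "degree G x + degree G y \<le> line_deg G {x, y} + 2"
proof -
  let ?X = "(\<lambda>z. {x, z}) ` (nbrs G x - {y})" and ?Y = "(\<lambda>z. {y, z}) ` (nbrs G y - {x})"
  let ?L = "{e'. line_adj G {x, y} e'}"
  have ne: "x \<noteq> y"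
    using a adj_irrefl by blast
  have y: "y \<in> nbrs G x" and x: "x \<in> nbrs G y"
    using a adj_sym by (auto simp: nbrs_def)
  have "?L \<subseteq> (\<lambda>z. {x, z}) ` nbrs G x \<union> (\<lambda>z. {y, z}) ` nbrs G y"
  proof
    fix e assume "e \<in> ?L"
    then have e: "e \<in> edges G" and m: "{x, y} \<inter> e \<noteq> {}"
      by (auto simp: line_adj_def)
    obtain p q where pq: "adj G p q" "e = {p, q}"
      using e by (rule edgesE)
    then have "adj G q p" "e = {q, p}"
      using adj_sym by auto
    then show "e \<in> (\<lambda>z. {x, z}) ` nbrs G x \<union> (\<lambda>z. {y, z}) ` nbrs G y"
      using pq m unfolding nbrs_def by blast
  qed
  then have fin: "finite ?L"
    using finite_nbrs by (meson finite_UnI finite_imageI finite_subset)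
  have sub: "?X \<union> ?Y \<subseteq> ?L"
  proof -
    have "line_adj G {x, y} {x, z}" if "z \<in> nbrs G x - {y}" for z
      using that edgesI[OF a] edgesI[of x z] ne
      by (auto simp: line_adj_def nbrs_def doubleton_eq_iff)
    moreover have "line_adj G {x, y} {y, z}" if "z \<in> nbrs G y - {x}" for z
      using that edgesI[OF a] edgesI[of y z] ne
      by (auto simp: line_adj_def nbrs_def doubleton_eq_iff)
    ultimately show ?thesis by blast
  qed
  have disj: "?X \<inter> ?Y = {}"
    using ne by (auto simp: doubleton_eq_iff)
  have "card ?X = degree G x - 1" "card ?Y = degree G y - 1"
    using x y by (subst card_image; auto simp: inj_on_def doubleton_eq_iff degree_def)+
  then have "degree G x - 1 + (degree G y - 1) = card (?X \<union> ?Y)"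
    using finite_nbrs by (subst card_Un_disjoint[OF _ _ disj]) auto
  also have "\<dots> \<le> line_deg G {x, y}"
    unfolding line_deg_def by (rule card_mono[OF fin sub])
  finally show ?thesis
    by linarith
qed

section \<open>The space of square summable cochains\<close>

lemma cochain_antisym: "f \<in> cochains G \<Longrightarrow> f y x = - f x y"
  unfolding cochains_def by blast

lemma cochain_off_edges: "f \<in> cochains G \<Longrightarrow> \<not> adj G x y \<Longrightarrow> f x y = 0"
  unfolding cochains_def by blast

lemma cochainsI:
  assumes "\<And>x y. adj G x y \<Longrightarrow> f y x = - f x y" "\<And>x y. \<not> adj G x y \<Longrightarrow> f x y = 0"
  shows "f \<in> cochains G"
proof -
  have "f y x = - f x y" for x y
    using assms(1)[of x y] assms(2)[of x y] assms(2)[of y x] adj_sym[of x y]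
    by (cases "adj G x y") simp_all
  with assms(2) show ?thesis unfolding cochains_def by blast
qed

lemma energy_sym:
  assumes "edge_weight G w" "f \<in> cochains G" "adj G x y"
  shows "w x y * (cmod (f x y))\<^sup>2 = w y x * (cmod (f y x))\<^sup>2"
proof -
  have "w x y = w y x"
    using assms unfolding edge_weight_def by blast
  moreover have "f y x = - f x y"
    by (rule cochain_antisym[OF assms(2)])
  ultimately show ?thesis by simp
qed

lemma l2_iff:
  assumes "edge_weight G w"
  shows "f \<in> l2 G w \<longleftrightarrow> f \<in> cochains G \<and>
    (\<lambda>(x, y). w x y * (cmod (f x y))\<^sup>2) summable_on darts G"
  using summable_darts_iff[of "\<lambda>x y. w x y * (cmod (f x y))\<^sup>2"] energy_sym[OF assms]
  by (auto simp: l2_def)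

lemma edge_energy_nonneg:
  assumes "edge_weight G w" "f \<in> cochains G" "e \<in> edges G"
  shows "0 \<le> edge_value (\<lambda>x y. w x y * (cmod (f x y))\<^sup>2) e"
proof -
  obtain x y where xy: "e = {x, y}" "adj G x y"
    using assms(3) by (auto simp: edges_def)
  then show ?thesis
    using edge_value_pair[of "\<lambda>x y. w x y * (cmod (f x y))\<^sup>2", OF energy_sym[OF assms(1,2)]] assms(1)
    by (simp add: edge_weight_def less_imp_le)
qed

lemma l2_norm_sq_edges:
  assumes "edge_weight G w" "f \<in> cochains G"
  shows "(l2_norm G w f)\<^sup>2 = infsum (edge_value (\<lambda>x y. w x y * (cmod (f x y))\<^sup>2)) (edges G)"
  unfolding l2_norm_def by (rule real_sqrt_pow2, rule infsum_nonneg, rule edge_energy_nonneg[OF assms])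

lemma l2_norm_sq:
  assumes "edge_weight G w" "f \<in> cochains G"
  shows "(l2_norm G w f)\<^sup>2 = infsum (\<lambda>(x, y). w x y * (cmod (f x y))\<^sup>2) (darts G) / 2"
  unfolding l2_norm_sq_edges[OF assms]
  by (subst infsum_darts_eq[OF energy_sym[OF assms]]) auto

lemma l2_norm_nonneg:
  assumes "edge_weight G w" "f \<in> cochains G"
  shows "0 \<le> l2_norm G w f"
  unfolding l2_norm_def by (rule real_sqrt_ge_zero, rule infsum_nonneg, rule edge_energy_nonneg[OF assms])

lemma l2_inner_darts:
  assumes "edge_weight G w" "f \<in> cochains G" "g \<in> cochains G"
  shows "2 * l2_inner G w f g
    = infsum (\<lambda>(x, y). of_real (w x y) * f x y * cnj (g x y)) (darts G)"
proof -
  have "of_real (w x y) * f x y * cnj (g x y) = of_real (w y x) * f y x * cnj (g y x)"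
    if "adj G x y" for x y
  proof -
    have "w x y = w y x"
      using assms that unfolding edge_weight_def by blast
    moreover have "f y x = - f x y" "g y x = - g x y"
      by (rule cochain_antisym[OF assms(2)], rule cochain_antisym[OF assms(3)])
    ultimately show ?thesis by simp
  qed
  from infsum_darts_eq[of "\<lambda>x y. of_real (w x y) * f x y * cnj (g x y)", OF this]
  show ?thesis by (simp add: l2_inner_def)
qed

lemma l2_comparison:
  assumes w: "edge_weight G w" and f: "f \<in> l2 G w" and g: "g \<in> cochains G"
    and le: "\<And>x y. adj G x y \<Longrightarrow> cmod (g x y) \<le> cmod (f x y)"
  shows "g \<in> l2 G w"
proof -
  have "(\<lambda>(x, y). w x y * (cmod (g x y))\<^sup>2) summable_on darts G"
  proof (rule summable_on_comparison_test[where f="\<lambda>(x, y). w x y * (cmod (f x y))\<^sup>2"])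
    show "(\<lambda>(x, y). w x y * (cmod (f x y))\<^sup>2) summable_on darts G"
      using f l2_iff[OF w] by blast
  next
    show "(case p of (x, y) \<Rightarrow> w x y * (cmod (g x y))\<^sup>2) \<le> (case p of (x, y) \<Rightarrow> w x y * (cmod (f x y))\<^sup>2)"
      "0 \<le> (case p of (x, y) \<Rightarrow> w x y * (cmod (g x y))\<^sup>2)" if "p \<in> darts G" for p
      using that le edge_weight_nonneg[OF w]
      by (auto simp: darts_def intro!: mult_left_mono power_mono)
  qed
  then show ?thesis using g l2_iff[OF w] by blast
qed

lemma l2_scale:
  assumes w: "edge_weight G w" and f: "f \<in> l2 G w"
  shows "(\<lambda>x y. c * f x y) \<in> l2 G w" "l2_norm G w (\<lambda>x y. c * f x y) = cmod c * l2_norm G w f"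
proof -
  have fc: "f \<in> cochains G" and s: "(\<lambda>(x, y). w x y * (cmod (f x y))\<^sup>2) summable_on darts G"
    using f l2_iff[OF w] by auto
  have c: "(\<lambda>x y. c * f x y) \<in> cochains G"
    by (rule cochainsI) (metis cochain_antisym[OF fc] mult_minus_right, simp add: cochain_off_edges[OF fc])
  have eq: "(\<lambda>(x, y). w x y * (cmod (c * f x y))\<^sup>2)
      = (\<lambda>p. (cmod c)\<^sup>2 * (case p of (x, y) \<Rightarrow> w x y * (cmod (f x y))\<^sup>2))"
    by (auto simp: norm_mult power_mult_distrib)
  show "(\<lambda>x y. c * f x y) \<in> l2 G w"
    unfolding l2_iff[OF w] eq using c summable_on_cmult_right[OF s] by blast
  have "(l2_norm G w (\<lambda>x y. c * f x y))\<^sup>2 = (cmod c * l2_norm G w f)\<^sup>2"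
    unfolding l2_norm_sq[OF w c] power_mult_distrib l2_norm_sq[OF w fc] eq
    by (subst infsum_cmult_right') simp
  then show "l2_norm G w (\<lambda>x y. c * f x y) = cmod c * l2_norm G w f"
    using l2_norm_nonneg[OF w c] l2_norm_nonneg[OF w fc]
    by (simp add: power2_eq_iff_nonneg)
qed

text \<open>Evaluation at an edge is continuous on the \<open>\<ell>\<^sup>2\<close> space. This allows operators to be
  compared value by value.\<close>

lemma pointwise_le_l2_norm:
  assumes w: "edge_weight G w" and f: "f \<in> l2 G w" and a: "adj G x y"
  shows "w x y * (cmod (f x y))\<^sup>2 \<le> (l2_norm G w f)\<^sup>2"
proof -
  let ?v = "edge_value (\<lambda>x y. w x y * (cmod (f x y))\<^sup>2)"
  have fc: "f \<in> cochains G" and s: "?v summable_on edges G"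
    using f by (auto simp: l2_def)
  have "w x y * (cmod (f x y))\<^sup>2 = sum ?v {{x, y}}"
    using edge_value_pair[of "\<lambda>x y. w x y * (cmod (f x y))\<^sup>2", OF energy_sym[OF w fc a]] by simp
  also have "\<dots> \<le> infsum ?v (edges G)"
  proof (rule finite_sum_le_infsum[OF s])
    show "{{x, y}} \<subseteq> edges G"
      using edgesI[OF a] by simp
  qed (use edge_energy_nonneg[OF w fc] in auto)
  also have "\<dots> = (l2_norm G w f)\<^sup>2"
    by (simp add: l2_norm_sq_edges[OF w fc])
  finally show ?thesis .
qed

lemma cochains_c_subset_l2:
  assumes w: "edge_weight G w"
  shows "cochains_c G \<subseteq> l2 G w"
proof
  fix f assume f: "f \<in> cochains_c G"
  have "(\<lambda>(x, y). w x y * (cmod (f x y))\<^sup>2) summable_on darts G"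
    using f by (intro finite_nonzero_values_imp_summable_on)
      (auto simp: cochains_c_def elim!: rev_finite_subset)
  then show "f \<in> l2 G w"
    using f l2_iff[OF w] by (auto simp: cochains_c_def)
qed

text \<open>With \<open>s = -1/2\<close> this goes from the unweighted space to the one with weight \<open>m\<^sub>1\<close>, and with
  \<open>s = 1/2\<close> it goes back.\<close>

lemma M1_pow_isometry:
  assumes w: "edge_weight G w" and w': "edge_weight G w'"
    and eq: "\<And>x y. adj G x y \<Longrightarrow> w' x y * (ewt G x y powr s)\<^sup>2 = w x y"
    and f: "f \<in> l2 G w"
  shows "M1_pow G s f \<in> l2 G w'" and "l2_norm G w' (M1_pow G s f) = l2_norm G w f"
proof -
  have fc: "f \<in> cochains G" and fs: "(\<lambda>(x, y). w x y * (cmod (f x y))\<^sup>2) summable_on darts G"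
    using f l2_iff[OF w] by auto
  have c: "M1_pow G s f \<in> cochains G"
  proof (rule cochainsI)
    show "M1_pow G s f y x = - M1_pow G s f x y" if "adj G x y" for x y
      using cochain_antisym[OF fc, of y x] ewt_sym[OF that] by (simp add: M1_pow_def)
  qed (simp add: M1_pow_def cochain_off_edges[OF fc])
  have e: "(case p of (x, y) \<Rightarrow> w' x y * (cmod (M1_pow G s f x y))\<^sup>2)
      = (case p of (x, y) \<Rightarrow> w x y * (cmod (f x y))\<^sup>2)" if "p \<in> darts G" for p
    using that by (auto simp: darts_def M1_pow_def norm_mult power_mult_distrib simp flip: eq)
  have "(\<lambda>(x, y). w' x y * (cmod (M1_pow G s f x y))\<^sup>2) summable_on darts G"
    by (subst summable_on_cong[OF e]) (simp_all add: fs)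
  with c show "M1_pow G s f \<in> l2 G w'"
    by (simp add: l2_iff[OF w'])
  have "(l2_norm G w' (M1_pow G s f))\<^sup>2 = (l2_norm G w f)\<^sup>2"
    unfolding l2_norm_sq[OF w' c] l2_norm_sq[OF w fc] by (subst infsum_cong[OF e]) simp_all
  then show "l2_norm G w' (M1_pow G s f) = l2_norm G w f"
    using l2_norm_nonneg[OF w' c] l2_norm_nonneg[OF w fc] by (simp add: power2_eq_iff_nonneg)
qed

end

section \<open>Bounded operators are determined on the finitely supported cochains\<close>

lemma operator_norm_le:
  assumes "\<And>f. f \<in> D \<Longrightarrow> A f \<in> l2 G w"
    and "\<And>f. f \<in> D \<Longrightarrow> l2_norm G w (A f) \<le> K * l2_norm G w f" and "0 \<le> K"
  shows "operator_norm G w D A \<le> ennreal K"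
  unfolding operator_norm_def
proof (rule SUP_least)
  fix f assume "f \<in> {f \<in> D. l2_norm G w f \<le> 1}"
  then have f: "f \<in> D" "l2_norm G w f \<le> 1" by auto
  have "l2_norm G w (A f) \<le> K"
    using assms(2)[OF f(1)] mult_left_mono[OF f(2) assms(3)] by linarith
  then show "(if A f \<in> l2 G w then ennreal (l2_norm G w (A f)) else top) \<le> ennreal K"
    using assms(1)[OF f(1)] by (simp add: ennreal_leI)
qed

definition restrict_edges :: "'v set set \<Rightarrow> 'v cochain_op" where
  "restrict_edges S f x y = (if {x, y} \<in> S then f x y else 0)"

context loc_fin_graph
begin

text \<open>Rescaling turns the bound on the unit ball into one on every ball. The radius \<open>r\<close> is
  kept apart from the norm of \<open>f\<close> so that no division by zero occurs when that norm vanishes.\<close>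

lemma bounded_operator_bound:
  assumes w: "edge_weight G w" and B: "bounded_operator G w B"
  obtains L where "0 \<le> L" "\<And>f r. f \<in> l2 G w \<Longrightarrow> 0 < r \<Longrightarrow> l2_norm G w f \<le> r \<Longrightarrow> l2_norm G w (B f) \<le> L * r"
proof -
  have maps: "\<And>f. f \<in> l2 G w \<Longrightarrow> B f \<in> l2 G w"
    and hom: "\<And>c f. f \<in> l2 G w \<Longrightarrow> B (\<lambda>x y. c * f x y) = (\<lambda>x y. c * B f x y)"
    and fin: "operator_norm G w (l2 G w) B < top"
    using B by (auto simp: bounded_operator_def)
  obtain L where L: "0 \<le> L" "operator_norm G w (l2 G w) B = ennreal L"
    using fin by (cases "operator_norm G w (l2 G w) B") auto
  have "l2_norm G w (B f) \<le> L * r" if f: "f \<in> l2 G w" and r: "0 < r" "l2_norm G w f \<le> r" for f r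
  proof -
    let ?c = "of_real (1 / r) :: complex"
    let ?g = "\<lambda>x y. ?c * f x y"
    have g: "?g \<in> l2 G w" "l2_norm G w ?g \<le> 1"
      using l2_scale[OF w f, of ?c] r by (auto simp: norm_divide)
    have Bf: "B f \<in> cochains G"
      using maps[OF f] by (simp add: l2_def)
    have "ennreal (l2_norm G w (B ?g)) \<le> operator_norm G w (l2 G w) B"
      unfolding operator_norm_def
      by (rule SUP_upper2[of ?g]) (use g maps[OF g(1)] in auto)
    then have "l2_norm G w (B ?g) \<le> L"
      using L by (simp add: ennreal_le_iff)
    moreover have "l2_norm G w (B ?g) = l2_norm G w (B f) / r"
      unfolding hom[OF f] l2_scale(2)[OF w maps[OF f]] using r by (simp add: norm_divide)
    ultimately have "l2_norm G w (B f) / r \<le> L"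
      by simp
    then show ?thesis
      using r(1) by (simp only: pos_divide_le_eq)
  qed
  then show ?thesis using that L by blast
qed

lemma restrict_edges_cochain:
  assumes "f \<in> cochains G"
  shows "restrict_edges S f \<in> cochains G"
proof (rule cochainsI)
  show "restrict_edges S f y x = - restrict_edges S f x y" for x y
    using cochain_antisym[OF assms, of y x] by (auto simp: restrict_edges_def insert_commute)
qed (simp add: restrict_edges_def cochain_off_edges[OF assms])

lemma restrict_edges_l2:
  assumes "edge_weight G w" "f \<in> l2 G w"
  shows "restrict_edges S f \<in> l2 G w"
  by (rule l2_comparison[OF assms restrict_edges_cochain])
    (use assms in \<open>auto simp: l2_def restrict_edges_def\<close>)

lemma restrict_edges_finite:
  assumes "f \<in> cochains G" "finite S" "S \<subseteq> edges G"
  shows "restrict_edges S f \<in> cochains_c G"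
proof -
  have "finite (\<Union>e\<in>S. e \<times> e)"
    using assms(2,3) by (intro finite_UN_I) (auto elim!: edgesE dest!: subsetD)
  moreover have "{(x, y). restrict_edges S f x y \<noteq> 0} \<subseteq> (\<Union>e\<in>S. e \<times> e)"
    by (auto simp: restrict_edges_def split: if_splits intro: bexI[of _ "{_, _}"])
  ultimately show ?thesis
    using restrict_edges_cochain[OF assms(1)] finite_subset by (auto simp: cochains_c_def)
qed

text \<open>The squared norm of the restriction of \<open>f\<close> to the complement of \<open>S\<close> is the tail over
  \<open>edges G - S\<close> of a convergent sum, which is small for a suitable finite \<open>S\<close>.\<close>

lemma l2_tail_small:
  assumes w: "edge_weight G w" and f: "f \<in> l2 G w" and r: "0 < r"
  obtains S where "finite S" "S \<subseteq> edges G" "l2_norm G w (restrict_edges (- S) f) \<le> r"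
proof -
  let ?v = "edge_value (\<lambda>x y. w x y * (cmod (f x y))\<^sup>2)"
  have fc: "f \<in> cochains G" and s: "?v summable_on edges G"
    using f by (auto simp: l2_def)
  obtain S where S: "finite S" "S \<subseteq> edges G" and d: "dist (sum ?v S) (infsum ?v (edges G)) \<le> r\<^sup>2"
    using infsum_finite_approximation[OF s, of "r\<^sup>2"] r by auto
  have "(l2_norm G w (restrict_edges (- S) f))\<^sup>2
      = infsum (edge_value (\<lambda>x y. w x y * (cmod (restrict_edges (- S) f x y))\<^sup>2)) (edges G)"
    by (rule l2_norm_sq_edges[OF w restrict_edges_cochain[OF fc]])
  also have "\<dots> = infsum ?v (edges G - S)"
  proof (rule infsum_cong_neutral)
    have *: "edge_value (\<lambda>x y. w x y * (cmod (restrict_edges (- S) f x y))\<^sup>2) e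
        = (if e \<in> S then 0 else ?v e)" if e_in: "e \<in> edges G" for e
    proof -
      obtain x y where a: "adj G x y" and e: "e = {x, y}"
        by (rule edgesE[OF e_in])
      show ?thesis
        unfolding e edge_value_pair[of "\<lambda>x y. w x y * (cmod (f x y))\<^sup>2", OF energy_sym[OF w fc a]]
          edge_value_pair[of "\<lambda>x y. w x y * (cmod (restrict_edges (- S) f x y))\<^sup>2",
            OF energy_sym[OF w restrict_edges_cochain[OF fc] a]]
        by (simp add: restrict_edges_def)
    qed
    show "edge_value (\<lambda>x y. w x y * (cmod (restrict_edges (- S) f x y))\<^sup>2) e = 0"
      if "e \<in> edges G - (edges G - S)" for e
      using * that by auto
    show "edge_value (\<lambda>x y. w x y * (cmod (restrict_edges (- S) f x y))\<^sup>2) e = ?v e"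
      if "e \<in> edges G \<inter> (edges G - S)" for e
      using * that by auto
  qed auto
  also have "\<dots> = infsum ?v (edges G) - sum ?v S"
    using infsum_Diff[OF s summable_on_finite[OF S(1)] S(2)] S(1) by simp
  also have "\<dots> \<le> r\<^sup>2"
    using d by (simp add: dist_real_def abs_le_iff)
  finally have "l2_norm G w (restrict_edges (- S) f) \<le> r"
    using r by (simp add: power2_le_iff_abs_le)
  with S show ?thesis by (rule that)
qed

text \<open>The part of \<open>f\<close> on a finite set of edges contributes equally to \<open>A f\<close> and \<open>B f\<close>, so the
  difference only sees the tail, on which both operators are small. The comparison
  is made at one oriented edge at a time, where evaluation is continuous.\<close>

lemma bounded_operator_unique:
  assumes w: "edge_weight G w" and A: "bounded_operator G w A" and B: "bounded_operator G w B"
    and eq: "\<And>f. f \<in> cochains_c G \<Longrightarrow> A f = B f" and f: "f \<in> l2 G w"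
  shows "A f = B f"
proof (intro ext)
  fix x y
  have fc: "f \<in> cochains G" using f by (simp add: l2_def)
  have maps: "\<And>f. f \<in> l2 G w \<Longrightarrow> A f \<in> l2 G w" "\<And>f. f \<in> l2 G w \<Longrightarrow> B f \<in> l2 G w"
    using A B by (auto simp: bounded_operator_def)
  have add: "A (\<lambda>x y. f x y + g x y) = (\<lambda>x y. A f x y + A g x y)"
    "B (\<lambda>x y. f x y + g x y) = (\<lambda>x y. B f x y + B g x y)"
    if "f \<in> l2 G w" "g \<in> l2 G w" for f g
    using A B that by (auto simp: bounded_operator_def)
  obtain L where L: "0 \<le> L"
    "\<And>f r. f \<in> l2 G w \<Longrightarrow> 0 < r \<Longrightarrow> l2_norm G w f \<le> r \<Longrightarrow> l2_norm G w (A f) \<le> L * r"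
    using bounded_operator_bound[OF w A] by metis
  obtain M where M: "0 \<le> M"
    "\<And>f r. f \<in> l2 G w \<Longrightarrow> 0 < r \<Longrightarrow> l2_norm G w f \<le> r \<Longrightarrow> l2_norm G w (B f) \<le> M * r"
    using bounded_operator_bound[OF w B] by metis
  show "A f x y = B f x y"
  proof (cases "adj G x y")
    case False
    then show ?thesis
      using maps[OF f] by (auto simp: l2_def cochain_off_edges)
  next
    case True
    then have pos: "0 < w x y"
      using w by (simp add: edge_weight_def)
    have le: "cmod (h x y) \<le> K * r / sqrt (w x y)"
      if "h \<in> l2 G w" "l2_norm G w h \<le> K * r" for h K r
    proof -
      have "sqrt (w x y * (cmod (h x y))\<^sup>2) \<le> sqrt ((l2_norm G w h)\<^sup>2)"
        by (rule real_sqrt_le_mono[OF pointwise_le_l2_norm[OF w that(1) True]])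
      then have "sqrt (w x y) * cmod (h x y) \<le> l2_norm G w h"
        using l2_norm_nonneg[OF w, of h] that by (simp add: real_sqrt_mult l2_def)
      with that show ?thesis
        using pos by (simp add: field_simps)
    qed
    have bound: "cmod (A f x y - B f x y) \<le> (L + M) / sqrt (w x y) * r" if r: "0 < r" for r
    proof -
      obtain S where S: "finite S" "S \<subseteq> edges G"
        and tail: "l2_norm G w (restrict_edges (- S) f) \<le> r"
        using l2_tail_small[OF w f r] by blast
      let ?p = "restrict_edges S f" and ?q = "restrict_edges (- S) f"
      have p: "?p \<in> cochains_c G"
        by (rule restrict_edges_finite[OF fc S])
      have q: "?q \<in> l2 G w"
        by (rule restrict_edges_l2[OF w f])
      have pq: "f = (\<lambda>x y. ?p x y + ?q x y)"
        by (simp add: restrict_edges_def fun_eq_iff)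
      have p': "?p \<in> l2 G w"
        using p cochains_c_subset_l2[OF w] by blast
      have "A f x y = A ?p x y + A ?q x y"
        by (subst pq, subst add(1)[OF p' q]) (rule refl)
      moreover have "B f x y = B ?p x y + B ?q x y"
        by (subst pq, subst add(2)[OF p' q]) (rule refl)
      ultimately have "A f x y - B f x y = A ?q x y - B ?q x y"
        using eq[OF p] by simp
      also have "cmod \<dots> \<le> cmod (A ?q x y) + cmod (B ?q x y)"
        by (rule norm_triangle_ineq4)
      also have "\<dots> \<le> L * r / sqrt (w x y) + M * r / sqrt (w x y)"
        by (intro add_mono le maps q L(2) M(2) r tail)
      finally show ?thesis
        by (simp only: add_divide_distrib distrib_right times_divide_eq_left)
    qed
    have "cmod (A f x y - B f x y) \<le> 0"
    proof (rule field_le_epsilon)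
      fix e :: real assume e: "0 < e"
      let ?k = "(L + M) / sqrt (w x y)"
      have k: "0 \<le> ?k" using L(1) M(1) pos by simp
      have "cmod (A f x y - B f x y) \<le> ?k * (e / (?k + 1))"
        using e k by (intro bound) simp
      also have "\<dots> \<le> e"
      proof -
        have "k * (e / (k + 1)) \<le> e" if "0 \<le> k" for k :: real
          using e that by (simp add: field_simps)
        from this[OF k] show ?thesis .
      qed
      finally show "cmod (A f x y - B f x y) \<le> 0 + e" by simp
    qed
    then show ?thesis by simp
  qed
qed

section \<open>Bounds for the coboundary and the divergence\<close>

lemma d1_cochain: "d1 G u \<in> cochains G"
  by (rule cochainsI) (auto simp: d1_def adj_sym)

lemma Laplace1_cochain: "Laplace1 G f \<in> cochains G"
  by (simp add: Laplace1_def d1_cochain)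

lemma delta1_add: "delta1 G (\<lambda>x y. f x y + g x y) = (\<lambda>x. delta1 G f x + delta1 G g x)"
  by (simp add: delta1_def fun_eq_iff algebra_simps sum.distrib)

lemma delta1_scale: "delta1 G (\<lambda>x y. c * f x y) = (\<lambda>x. c * delta1 G f x)"
  by (simp add: delta1_def fun_eq_iff sum_distrib_left sum_divide_distrib mult_ac)

lemma Laplace1_add:
  "Laplace1 G (\<lambda>x y. f x y + g x y) = (\<lambda>x y. Laplace1 G f x y + Laplace1 G g x y)"
  by (simp add: Laplace1_def delta1_add d1_def fun_eq_iff)

lemma Laplace1_scale: "Laplace1 G (\<lambda>x y. c * f x y) = (\<lambda>x y. c * Laplace1 G f x y)"
  by (simp add: Laplace1_def delta1_scale d1_def fun_eq_iff algebra_simps)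

end

text \<open>By the triangle inequality \<open>|b - a| \<le> s + t\<close> with \<open>s = |a|\<close> and \<open>t = |b|\<close>, and the
  difference between the right-hand side and \<open>(s + t)\<^sup>2\<close> is the square \<open>(q s - p t)\<^sup>2 / (p q)\<close>.\<close>

lemma weighted_young:
  fixes p q :: real and a b :: complex
  assumes "0 < p" "0 < q"
  shows "(cmod (b - a))\<^sup>2 \<le> (p + q) * ((cmod a)\<^sup>2 / p + (cmod b)\<^sup>2 / q)"
proof -
  let ?s = "cmod a" and ?t = "cmod b"
  have "(cmod (b - a))\<^sup>2 \<le> (?t + ?s)\<^sup>2"
    by (intro power_mono norm_triangle_ineq4) simp
  also have "\<dots> \<le> (?t + ?s)\<^sup>2 + (q * ?s - p * ?t)\<^sup>2 / (p * q)"
    using assms by simp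
  also have "\<dots> = (p + q) * (?s\<^sup>2 / p + ?t\<^sup>2 / q)"
    using assms by (simp add: field_simps power2_eq_square)
  finally show ?thesis .
qed

text \<open>The constants behind the norm bound \<open>C N / c\<close>. In a graph with edges \<open>C\<close> and \<open>N\<close> are
  automatically nonnegative; the two sign conditions matter when there are no edges.\<close>

locale bounded_geometry = loc_fin_graph G for G :: "'v wgraph" +
  fixes c C N :: real
  assumes c_pos: "0 < c" and vwt_ge: "\<And>x. x \<in> verts G \<Longrightarrow> c \<le> vwt G x"
    and C_nonneg: "0 \<le> C" and ewt_le: "\<And>x y. adj G x y \<Longrightarrow> ewt G x y \<le> C"
    and N_nonneg: "0 \<le> N"
    and degree_sum_le: "\<And>x y. adj G x y \<Longrightarrow> real (degree G x) + real (degree G y) \<le> N"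
begin

definition l2_vertex :: "('v \<Rightarrow> complex) set" where
  "l2_vertex = {u. (\<lambda>x. vwt G x * (cmod (u x))\<^sup>2) summable_on verts G}"

definition vertex_energy :: "('v \<Rightarrow> complex) \<Rightarrow> real" where
  "vertex_energy u = infsum (\<lambda>x. vwt G x * (cmod (u x))\<^sup>2) (verts G)"

lemma degree_le: "real (degree G x) \<le> N"
proof (cases "nbrs G x = {}")
  case True
  then show ?thesis using N_nonneg by (simp add: degree_def)
next
  case False
  then obtain y where "adj G x y" by (auto simp: nbrs_def)
  then show ?thesis using degree_sum_le[of x y] by linarith
qed

lemma ewt_nonneg: "adj G x y \<Longrightarrow> 0 \<le> ewt G x y"
  by (simp add: adj_def)

text \<open>Cauchy-Schwarz at the vertex \<open>x\<close>, where one factor \<open>m\<^sub>1\<close> of \<open>m\<^sub>1\<^sup>2 |f|\<^sup>2\<close> is estimated by \<open>C\<close>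
  and the other one is kept for the energy of \<open>f\<close>.\<close>

lemma delta1_pointwise_bound:
  assumes f: "f \<in> cochains G" and x: "x \<in> verts G"
  shows "vwt G x * (cmod (delta1 G f x))\<^sup>2
    \<le> C / c * (\<Sum>y\<in>nbrs G x. real (degree G x) * (ewt G x y * (cmod (f x y))\<^sup>2))"
proof -
  let ?S = "\<Sum>y\<in>nbrs G x. of_real (ewt G x y) * f y x"
  have v: "0 < vwt G x" by (rule vwt_pos[OF x])
  have "cmod ?S \<le> (\<Sum>y\<in>nbrs G x. ewt G x y * cmod (f x y))"
  proof (rule sum_norm_le)
    fix y assume "y \<in> nbrs G x"
    then show "cmod (of_real (ewt G x y) * f y x) \<le> ewt G x y * cmod (f x y)"
      using ewt_nonneg[of x y] cochain_antisym[OF f, of y x] by (simp add: nbrs_def norm_mult)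
  qed
  then have "(cmod ?S)\<^sup>2 \<le> (\<Sum>y\<in>nbrs G x. ewt G x y * cmod (f x y))\<^sup>2"
    by (rule power_mono) simp
  also have "\<dots> \<le> (\<Sum>y\<in>nbrs G x. (ewt G x y * cmod (f x y))\<^sup>2) * real (degree G x)"
    unfolding degree_def by (rule sum_squared_le_sum_of_squares)
  also have "\<dots> \<le> (\<Sum>y\<in>nbrs G x. C * (ewt G x y * (cmod (f x y))\<^sup>2)) * real (degree G x)"
  proof (intro mult_right_mono sum_mono)
    fix y assume "y \<in> nbrs G x"
    then have "adj G x y" by (simp add: nbrs_def)
    then show "(ewt G x y * cmod (f x y))\<^sup>2 \<le> C * (ewt G x y * (cmod (f x y))\<^sup>2)"
      unfolding power_mult_distrib power2_eq_square[of "ewt G x y"] mult.assoc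
      using ewt_le ewt_nonneg by (intro mult_right_mono) auto
  qed simp
  finally have S: "(cmod ?S)\<^sup>2
      \<le> C * (\<Sum>y\<in>nbrs G x. real (degree G x) * (ewt G x y * (cmod (f x y))\<^sup>2))" (is "_ \<le> ?R")
    by (simp add: sum_distrib_left sum_distrib_right mult_ac)
  have "cmod (delta1 G f x) = cmod ?S / vwt G x"
    using v by (simp add: delta1_def nbrs_def norm_mult norm_divide)
  then have "vwt G x * (cmod (delta1 G f x))\<^sup>2 = (cmod ?S)\<^sup>2 / vwt G x"
    using v by (simp add: power2_eq_square)
  also have "\<dots> \<le> (cmod ?S)\<^sup>2 / c"
    using c_pos vwt_ge[OF x] by (intro divide_left_mono) auto
  also have "\<dots> \<le> ?R / c"
    using S c_pos by (simp add: divide_right_mono)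
  finally show ?thesis by simp
qed

text \<open>Summing the bounds at the vertices weights each oriented edge \<open>[x, y]\<close> with \<open>deg x\<close>. Together
  with the reversed edge this gives \<open>deg x + deg y \<le> N\<close> for each edge.\<close>

lemma delta1_bounded:
  assumes f: "f \<in> l2 G (ewt G)"
  shows "delta1 G f \<in> l2_vertex"
    and "vertex_energy (delta1 G f) \<le> C * N / c * (l2_norm G (ewt G) f)\<^sup>2"
proof -
  let ?h = "\<lambda>x y. ewt G x y * (cmod (f x y))\<^sup>2"
  let ?k = "\<lambda>x y. real (degree G x) * ?h x y"
  let ?t = "\<lambda>x. \<Sum>y\<in>nbrs G x. ?k x y"
  have fc: "f \<in> cochains G" and hs: "(\<lambda>(x, y). ?h x y) summable_on darts G"
    using f l2_iff[OF edge_weight_ewt] by auto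
  have h_nonneg: "0 \<le> ?h x y" if "adj G x y" for x y
    using ewt_nonneg[OF that] by simp
  have ks: "(\<lambda>(x, y). ?k x y) summable_on darts G"
  proof (rule summable_on_comparison_test[OF summable_on_cmult_right[OF hs, of N]])
    fix p assume p: "p \<in> darts G"
    obtain x y where xy: "p = (x, y)" "adj G x y"
      using p by (auto simp: darts_def)
    show "(case p of (x, y) \<Rightarrow> ?k x y) \<le> N * (case p of (x, y) \<Rightarrow> ?h x y)"
      unfolding xy(1) prod.case by (rule mult_right_mono[OF degree_le h_nonneg[OF xy(2)]])
    show "0 \<le> (case p of (x, y) \<Rightarrow> ?k x y)"
      unfolding xy(1) prod.case using h_nonneg[OF xy(2)] by simp
  qed
  have ks': "(\<lambda>(x, y). ?k y x) summable_on darts G"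
    using ks by (simp add: summable_darts_swap[of ?k])
  have ts: "?t summable_on verts G"
    using summable_darts_iff_verts[of ?k] h_nonneg ks by simp
  \<comment> \<open>Adding the sum with all edges reversed replaces the degree of one end by the degree sum.\<close>
  have "2 * infsum (\<lambda>(x, y). ?k x y) (darts G)
      = infsum (\<lambda>p. (case p of (x, y) \<Rightarrow> ?k x y) + (case p of (x, y) \<Rightarrow> ?k y x)) (darts G)"
    using infsum_add[OF ks ks'] infsum_darts_swap[of ?k] by simp
  also have "\<dots> \<le> infsum (\<lambda>p. N * (case p of (x, y) \<Rightarrow> ?h x y)) (darts G)"
  proof (rule infsum_mono[OF summable_on_add[OF ks ks'] summable_on_cmult_right[OF hs]])
    fix p assume p: "p \<in> darts G"
    obtain x y where xy: "p = (x, y)" "adj G x y"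
      using p by (auto simp: darts_def)
    have "?k x y + ?k y x = (real (degree G x) + real (degree G y)) * ?h x y"
      using energy_sym[OF edge_weight_ewt fc xy(2)] by (simp add: distrib_right)
    also have "\<dots> \<le> N * ?h x y"
      by (rule mult_right_mono[OF degree_sum_le h_nonneg]) (fact xy(2))+
    finally show "(case p of (x, y) \<Rightarrow> ?k x y) + (case p of (x, y) \<Rightarrow> ?k y x)
        \<le> N * (case p of (x, y) \<Rightarrow> ?h x y)"
      by (simp add: xy(1))
  qed
  also have "\<dots> = 2 * (N * (l2_norm G (ewt G) f)\<^sup>2)"
    by (simp add: infsum_cmult_right' l2_norm_sq[OF edge_weight_ewt fc])
  finally have k_le: "infsum ?t (verts G) \<le> N * (l2_norm G (ewt G) f)\<^sup>2"
    using infsum_darts_verts[OF ks] by simp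
  show mem: "delta1 G f \<in> l2_vertex"
    unfolding l2_vertex_def mem_Collect_eq
    by (rule summable_on_comparison_test[OF summable_on_cmult_right[OF ts, of "C / c"]])
      (use delta1_pointwise_bound[OF fc] vwt_pos in \<open>auto simp: less_imp_le\<close>)
  have "vertex_energy (delta1 G f) \<le> infsum (\<lambda>x. C / c * ?t x) (verts G)"
    unfolding vertex_energy_def
    by (rule infsum_mono[OF _ summable_on_cmult_right[OF ts]])
      (use mem delta1_pointwise_bound[OF fc] in \<open>auto simp: l2_vertex_def\<close>)
  also have "\<dots> = C / c * infsum ?t (verts G)"
    by (rule infsum_cmult_right')
  also have "\<dots> \<le> C / c * (N * (l2_norm G (ewt G) f)\<^sup>2)"
    using C_nonneg c_pos by (intro mult_left_mono[OF k_le]) simp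
  finally show "vertex_energy (delta1 G f) \<le> C * N / c * (l2_norm G (ewt G) f)\<^sup>2"
    by simp
qed

text \<open>The inequality \<open>weighted_young\<close> with the degrees as weights bounds the energy density of
  \<open>d u\<close> by \<open>C N\<close> times \<open>|u x|\<^sup>2 / deg x + |u y|\<^sup>2 / deg y\<close>. Since \<open>|u x|\<^sup>2 / deg x\<close> occurs once for
  each of the \<open>deg x\<close> neighbours of \<open>x\<close>, the sum over the edges at \<open>x\<close> is at most \<open>|u x|\<^sup>2\<close>.\<close>

lemma d1_bounded:
  assumes u: "u \<in> l2_vertex"
  shows "d1 G u \<in> l2 G (ewt G)"
    and "(l2_norm G (ewt G) (d1 G u))\<^sup>2 \<le> C * N / c * vertex_energy u"
proof -
  let ?p = "\<lambda>x (y::'v). (cmod (u x))\<^sup>2 / real (degree G x)"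
  let ?t = "\<lambda>x. \<Sum>y\<in>nbrs G x. ?p x y"
  let ?g = "\<lambda>x y. ewt G x y * (cmod (d1 G u x y))\<^sup>2"
  let ?v = "\<lambda>x. vwt G x * (cmod (u x))\<^sup>2"
  have us: "?v summable_on verts G"
    using u by (simp add: l2_vertex_def)
  have t_le: "?t x \<le> 1 / c * ?v x" if "x \<in> verts G" for x
  proof -
    \<comment> \<open>Equality unless \<open>x\<close> is isolated, where the sum is empty.\<close>
    have "?t x \<le> (cmod (u x))\<^sup>2"
      by (simp flip: degree_def)
    also have "\<dots> \<le> 1 / c * ?v x"
      using c_pos mult_right_mono[OF vwt_ge[OF that], of "(cmod (u x))\<^sup>2"] by (simp add: field_simps)
    finally show ?thesis .
  qed
  have ts: "?t summable_on verts G"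
    by (rule summable_on_comparison_test[OF summable_on_cmult_right[OF us, of "1 / c"]])
      (use t_le in \<open>auto intro!: sum_nonneg\<close>)
  have ps: "(\<lambda>(x, y). ?p x y) summable_on darts G"
    using summable_darts_iff_verts[of ?p] ts by simp
  have ps': "(\<lambda>(x, y). ?p y x) summable_on darts G"
    using ps by (simp only: summable_darts_swap[of ?p])
  have "infsum (\<lambda>(x, y). ?p x y) (darts G) = infsum ?t (verts G)"
    by (rule infsum_darts_verts[OF ps])
  also have "\<dots> \<le> infsum (\<lambda>x. 1 / c * ?v x) (verts G)"
    by (rule infsum_mono[OF ts summable_on_cmult_right[OF us] t_le])
  also have "\<dots> = vertex_energy u / c"
    unfolding vertex_energy_def by (subst infsum_cmult_right') simp
  finally have p_le: "infsum (\<lambda>(x, y). ?p x y) (darts G) \<le> vertex_energy u / c" .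
  let ?q = "\<lambda>p. C * N * ((case p of (x, y) \<Rightarrow> ?p x y) + (case p of (x, y) \<Rightarrow> ?p y x))"
  have qs: "?q summable_on darts G"
    by (rule summable_on_cmult_right[OF summable_on_add[OF ps ps']])
  have g_le: "(case p of (x, y) \<Rightarrow> ?g x y) \<le> ?q p" and g_nonneg: "0 \<le> (case p of (x, y) \<Rightarrow> ?g x y)"
    if p_in: "p \<in> darts G" for p
  proof -
    obtain x y where xy: "p = (x, y)" "adj G x y"
      using p_in by (auto simp: darts_def)
    have pos: "0 < real (degree G x)" "0 < real (degree G y)"
      using degree_pos xy(2) adj_sym by auto
    have "?g x y \<le> C * ((real (degree G x) + real (degree G y)) * (?p x y + ?p y x))"
      using weighted_young[OF pos, of "u y" "u x"] ewt_le[OF xy(2)] ewt_nonneg[OF xy(2)] C_nonneg xy(2)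
      by (intro mult_mono) (auto simp: d1_def)
    also have "\<dots> \<le> C * (N * (?p x y + ?p y x))"
      using degree_sum_le[OF xy(2)] by (intro mult_left_mono[OF _ C_nonneg] mult_right_mono) auto
    finally show "(case p of (x, y) \<Rightarrow> ?g x y) \<le> ?q p"
      by (simp add: xy(1) mult.assoc)
    show "0 \<le> (case p of (x, y) \<Rightarrow> ?g x y)"
      using ewt_nonneg[OF xy(2)] by (simp add: xy(1))
  qed
  have gs: "(\<lambda>(x, y). ?g x y) summable_on darts G"
    by (rule summable_on_comparison_test[OF qs g_le g_nonneg])
  then show "d1 G u \<in> l2 G (ewt G)"
    using l2_iff[OF edge_weight_ewt] d1_cochain by blast
  have "infsum (\<lambda>(x, y). ?g x y) (darts G) \<le> infsum ?q (darts G)"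
    by (rule infsum_mono[OF gs qs g_le])
  also have "\<dots> = C * N * (2 * infsum (\<lambda>(x, y). ?p x y) (darts G))"
    unfolding infsum_cmult_right' infsum_add[OF ps ps'] infsum_darts_swap[of ?p] by simp
  also have "\<dots> \<le> C * N * (2 * (vertex_energy u / c))"
    using p_le C_nonneg N_nonneg by (intro mult_left_mono) auto
  finally show "(l2_norm G (ewt G) (d1 G u))\<^sup>2 \<le> C * N / c * vertex_energy u"
    unfolding l2_norm_sq[OF edge_weight_ewt d1_cochain] by (simp add: mult_ac)
qed

lemma Laplace1_l2: "f \<in> l2 G (ewt G) \<Longrightarrow> Laplace1 G f \<in> l2 G (ewt G)"
  unfolding Laplace1_def by (intro d1_bounded delta1_bounded)

lemma Laplace1_bound:
  assumes f: "f \<in> l2 G (ewt G)"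
  shows "l2_norm G (ewt G) (Laplace1 G f) \<le> C * N / c * l2_norm G (ewt G) f"
proof -
  let ?K = "C * N / c"
  have K: "0 \<le> ?K"
    using C_nonneg N_nonneg c_pos by simp
  have "(l2_norm G (ewt G) (Laplace1 G f))\<^sup>2 \<le> ?K * vertex_energy (delta1 G f)"
    unfolding Laplace1_def by (rule d1_bounded(2)[OF delta1_bounded(1)[OF f]])
  also have "\<dots> \<le> ?K * (?K * (l2_norm G (ewt G) f)\<^sup>2)"
    by (rule mult_left_mono[OF delta1_bounded(2)[OF f] K])
  finally have "(l2_norm G (ewt G) (Laplace1 G f))\<^sup>2 \<le> (?K * l2_norm G (ewt G) f)\<^sup>2"
    by (simp only: power_mult_distrib power2_eq_square[of ?K] mult.assoc)
  then show ?thesis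
    by (rule power2_le_imp_le) (intro mult_nonneg_nonneg K l2_norm_nonneg[OF edge_weight_ewt], use f in \<open>simp add: l2_def\<close>)
qed

lemma Laplace1_bounded_operator: "bounded_operator G (ewt G) (Laplace1 G)"
proof -
  have "operator_norm G (ewt G) (l2 G (ewt G)) (Laplace1 G) \<le> ennreal (C * N / c)"
    using C_nonneg N_nonneg c_pos
    by (intro operator_norm_le Laplace1_l2 Laplace1_bound) auto
  then show ?thesis
    unfolding bounded_operator_def
    using Laplace1_l2 Laplace1_add Laplace1_scale le_less_trans[OF _ ennreal_less_top] by blast
qed

text \<open>Summation by parts. On an oriented edge the integrand is \<open>k(x, y) + k(y, x)\<close> with
  \<open>k(x, y) = m\<^sub>1 (x, y) u(x) cnj (g(y, x))\<close>, because \<open>g\<close> is antisymmetric. The two parts have the same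
  sum over the oriented edges, and the sum of \<open>k\<close> over the neighbours of \<open>x\<close> is \<open>m\<^sub>0 u cnj (\<delta> g)\<close> at \<open>x\<close>.
  Splitting the sum needs absolute convergence, by \<open>2 |u| |g| \<le> |u|\<^sup>2 + |g|\<^sup>2\<close> and the bound on the degrees.\<close>

lemma d1_adjoint_delta1:
  assumes u: "u \<in> l2_vertex" and g: "g \<in> l2 G (ewt G)"
  shows "l2_inner G (ewt G) (d1 G u) g
    = infsum (\<lambda>x. of_real (vwt G x) * u x * cnj (delta1 G g x)) (verts G)"
proof -
  let ?k = "\<lambda>x y. of_real (ewt G x y) * u x * cnj (g y x)"
  let ?a = "\<lambda>x y. ewt G x y * (cmod (u x))\<^sup>2" and ?b = "\<lambda>x y. ewt G x y * (cmod (g x y))\<^sup>2"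
  have gc: "g \<in> cochains G" and bs: "(\<lambda>(x, y). ?b x y) summable_on darts G"
    using g l2_iff[OF edge_weight_ewt] by auto
  have us: "(\<lambda>x. vwt G x * (cmod (u x))\<^sup>2) summable_on verts G"
    using u by (simp add: l2_vertex_def)
  have "(\<lambda>x. \<Sum>y\<in>nbrs G x. ?a x y) summable_on verts G"
  proof (rule summable_on_comparison_test[OF summable_on_cmult_right[OF us, of "C * N / c"]])
    fix x assume x: "x \<in> verts G"
    have "(\<Sum>y\<in>nbrs G x. ?a x y) \<le> (\<Sum>y\<in>nbrs G x. C * (cmod (u x))\<^sup>2)"
      by (intro sum_mono mult_right_mono) (auto simp: nbrs_def ewt_le)
    also have "\<dots> = real (degree G x) * (C * (cmod (u x))\<^sup>2)"
      by (simp add: degree_def)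
    also have "\<dots> \<le> N * (C * (cmod (u x))\<^sup>2)"
      using C_nonneg by (intro mult_right_mono[OF degree_le]) simp
    also have "\<dots> = C * N / c * (c * (cmod (u x))\<^sup>2)"
      using c_pos by simp
    also have "\<dots> \<le> C * N / c * (vwt G x * (cmod (u x))\<^sup>2)"
      using C_nonneg N_nonneg c_pos vwt_ge[OF x] by (intro mult_left_mono mult_right_mono) auto
    finally show "(\<Sum>y\<in>nbrs G x. ?a x y) \<le> C * N / c * (vwt G x * (cmod (u x))\<^sup>2)" .
    show "0 \<le> (\<Sum>y\<in>nbrs G x. ?a x y)"
      by (intro sum_nonneg) (simp add: nbrs_def ewt_nonneg)
  qed
  then have as: "(\<lambda>(x, y). ?a x y) summable_on darts G"
    using summable_darts_iff_verts[of ?a] ewt_nonneg by simp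
  have ks: "(\<lambda>(x, y). ?k x y) summable_on darts G"
  proof (rule abs_summable_summable, rule summable_on_comparison_test[OF summable_on_add[OF as bs]])
    fix p assume "p \<in> darts G"
    then obtain x y where xy: "p = (x, y)" "adj G x y"
      by (auto simp: darts_def)
    let ?s = "cmod (u x)" and ?t = "cmod (g x y)"
    have "?s * ?t \<le> ?s\<^sup>2 + ?t\<^sup>2"
      using sum_squares_bound[of ?s ?t] mult_nonneg_nonneg[of ?s ?t, OF norm_ge_zero norm_ge_zero]
      by linarith
    then have "ewt G x y * (?s * ?t) \<le> ewt G x y * (?s\<^sup>2 + ?t\<^sup>2)"
      by (rule mult_left_mono[OF _ ewt_nonneg[OF xy(2)]])
    moreover have "cmod (g y x) = ?t"
      using cochain_antisym[OF gc, of y x] by simp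
    ultimately show "norm (case p of (x, y) \<Rightarrow> ?k x y)
        \<le> (case p of (x, y) \<Rightarrow> ?a x y) + (case p of (x, y) \<Rightarrow> ?b x y)"
      using ewt_nonneg[OF xy(2)] by (simp add: xy(1) norm_mult distrib_left mult.assoc)
  qed simp
  have ks': "(\<lambda>(x, y). ?k y x) summable_on darts G"
    using ks by (simp only: summable_darts_swap[of ?k])
  have "2 * l2_inner G (ewt G) (d1 G u) g
      = infsum (\<lambda>(x, y). of_real (ewt G x y) * d1 G u x y * cnj (g x y)) (darts G)"
    by (rule l2_inner_darts[OF edge_weight_ewt d1_cochain gc])
  also have "\<dots> = infsum (\<lambda>p. (case p of (x, y) \<Rightarrow> ?k x y) + (case p of (x, y) \<Rightarrow> ?k y x)) (darts G)"
  proof (rule infsum_cong)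
    fix p assume "p \<in> darts G"
    then obtain x y where xy: "p = (x, y)" "adj G x y"
      by (auto simp: darts_def)
    show "(case p of (x, y) \<Rightarrow> of_real (ewt G x y) * d1 G u x y * cnj (g x y))
        = (case p of (x, y) \<Rightarrow> ?k x y) + (case p of (x, y) \<Rightarrow> ?k y x)"
      using cochain_antisym[OF gc, of y x] ewt_sym[OF xy(2)] xy(2)
      by (simp add: xy(1) d1_def algebra_simps)
  qed
  also have "\<dots> = 2 * infsum (\<lambda>(x, y). ?k x y) (darts G)"
    unfolding infsum_add[OF ks ks'] infsum_darts_swap[of ?k] by simp
  also have "infsum (\<lambda>(x, y). ?k x y) (darts G) = infsum (\<lambda>x. \<Sum>y\<in>nbrs G x. ?k x y) (verts G)"
    by (rule infsum_darts_verts[OF ks])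
  also have "\<dots> = infsum (\<lambda>x. of_real (vwt G x) * u x * cnj (delta1 G g x)) (verts G)"
  proof (rule infsum_cong)
    fix x assume "x \<in> verts G"
    then show "(\<Sum>y\<in>nbrs G x. ?k x y) = of_real (vwt G x) * u x * cnj (delta1 G g x)"
      using vwt_pos[of x]
      by (simp add: delta1_def nbrs_def sum_distrib_left mult_ac)
  qed
  finally show ?thesis by simp
qed

text \<open>Both sides equal \<open>\<langle>\<delta> f, \<delta> g\<rangle>\<close>; for the right-hand side the adjointness of \<open>d\<close> and \<open>\<delta>\<close> is
  combined with the Hermitian symmetry of the inner products.\<close>

lemma Laplace1_self_adjoint: "self_adjoint G (ewt G) (Laplace1 G)"
  unfolding self_adjoint_def
proof (intro ballI)
  fix f g assume f: "f \<in> l2 G (ewt G)" and g: "g \<in> l2 G (ewt G)"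
  have fc: "f \<in> cochains G" and gc: "g \<in> cochains G"
    using f g by (auto simp: l2_def)
  have form: "l2_inner G (ewt G) (Laplace1 G f) g
      = infsum (\<lambda>x. of_real (vwt G x) * delta1 G f x * cnj (delta1 G g x)) (verts G)"
    if "f \<in> l2 G (ewt G)" "g \<in> l2 G (ewt G)" for f g
    unfolding Laplace1_def by (rule d1_adjoint_delta1[OF delta1_bounded(1)[OF that(1)] that(2)])
  have "2 * l2_inner G (ewt G) f (Laplace1 G g) = cnj (2 * l2_inner G (ewt G) (Laplace1 G g) f)"
    unfolding l2_inner_darts[OF edge_weight_ewt fc Laplace1_cochain]
      l2_inner_darts[OF edge_weight_ewt Laplace1_cochain fc] infsum_cnj[symmetric]
    by (simp add: case_prod_unfold mult_ac)
  also have "\<dots> = 2 * l2_inner G (ewt G) (Laplace1 G f) g"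
    unfolding form[OF f g] form[OF g f] complex_cnj_mult infsum_cnj[symmetric]
    by (simp add: mult_ac)
  finally show "l2_inner G (ewt G) (Laplace1 G f) g = l2_inner G (ewt G) f (Laplace1 G g)"
    by simp
qed

lemma normalized_Laplace1_bound:
  assumes f: "f \<in> l2 G (\<lambda>_ _. 1)"
  shows "normalized_Laplace1 G f \<in> l2 G (\<lambda>_ _. 1)"
    and "l2_norm G (\<lambda>_ _. 1) (normalized_Laplace1 G f) \<le> C * N / c * l2_norm G (\<lambda>_ _. 1) f"
proof -
  have f': "M1_pow G (-1/2) f \<in> l2 G (ewt G)"
    "l2_norm G (ewt G) (M1_pow G (-1/2) f) = l2_norm G (\<lambda>_ _. 1) f"
    using M1_pow_isometry[OF edge_weight_one edge_weight_ewt _ f, of "-1/2"]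
    by (auto simp: adj_def powr_minus power_inverse field_simps powr_half_sqrt)
  have "normalized_Laplace1 G f \<in> l2 G (\<lambda>_ _. 1) \<and>
    l2_norm G (\<lambda>_ _. 1) (normalized_Laplace1 G f)
      = l2_norm G (ewt G) (Laplace1 G (M1_pow G (-1/2) f))"
    unfolding normalized_Laplace1_def
    using M1_pow_isometry[OF edge_weight_ewt edge_weight_one _ Laplace1_l2[OF f'(1)], of "1/2"]
    by (auto simp: adj_def powr_half_sqrt)
  then show "normalized_Laplace1 G f \<in> l2 G (\<lambda>_ _. 1)"
    "l2_norm G (\<lambda>_ _. 1) (normalized_Laplace1 G f) \<le> C * N / c * l2_norm G (\<lambda>_ _. 1) f"
    using Laplace1_bound[OF f'(1)] f'(2) by auto
qed

end

section \<open>The norm bound and the self-adjoint extension\<close>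

theorem proposition7p6:
  fixes G :: "'v wgraph" and c0 C0 c1 C1 :: real
  assumes "weighted_graph G" and "locally_finite G"
    and "line_max_deg G < \<infinity>"
    and "0 < c0" and "\<forall>x\<in>verts G. c0 \<le> vwt G x \<and> vwt G x \<le> C0"
    and "0 < c1" and "\<forall>x y. adj G x y \<longrightarrow> c1 \<le> ewt G x y \<and> ewt G x y \<le> C1"
  shows "operator_norm G (ewt G) (cochains_c G) (Laplace1 G)
           \<le> ennreal (C1 / c0) * (ennreal_of_enat (line_max_deg G) + 2)
       \<and> (\<exists>A. bounded_operator G (ewt G) A \<and> self_adjoint G (ewt G) A
             \<and> (\<forall>f\<in>cochains_c G. A f = Laplace1 G f)
             \<and> (\<forall>B. bounded_operator G (ewt G) B \<and> (\<forall>f\<in>cochains_c G. B f = Laplace1 G f)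
                  \<longrightarrow> (\<forall>f\<in>l2 G (ewt G). B f = A f)))
       \<and> operator_norm G (\<lambda>_ _. 1) (l2 G (\<lambda>_ _. 1)) (normalized_Laplace1 G)
           \<le> ennreal (C1 / c0) * (ennreal_of_enat (line_max_deg G) + 2)"
proof -
  obtain d where d: "line_max_deg G = enat d"
    using assms(3) by (cases "line_max_deg G") auto
  interpret L: loc_fin_graph G
    using assms(1,2) by unfold_locales
  \<comment> \<open>If there are no edges, \<open>C1\<close> may be negative, while \<open>ennreal\<close> truncates it to \<open>0\<close>.\<close>
  interpret bounded_geometry G c0 "max 0 C1" "real (d + 2)"
  proof unfold_locales
    fix x y assume a: "adj G x y"
    have "enat (line_deg G {x, y}) \<le> line_max_deg G"
      unfolding line_max_deg_def by (rule SUP_upper[OF L.edgesI[OF a]])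
    then show "real (degree G x) + real (degree G y) \<le> real (d + 2)"
      using L.degree_sum_le_line_deg[OF a] d by simp
  next
    show "adj G x y \<Longrightarrow> ewt G x y \<le> max 0 C1" for x y
      using assms(7) by (meson max.coboundedI2)
  qed (use assms in auto)
  have K: "ennreal (C1 / c0) * (ennreal_of_enat (line_max_deg G) + 2)
      = ennreal (max 0 C1 * real (d + 2) / c0)"
  proof -
    have "ennreal (C1 / c0) = ennreal (max 0 C1 / c0)"
      using assms(4) by (cases "0 \<le> C1") (auto simp: ennreal_neg divide_nonpos_pos)
    moreover have "ennreal_of_enat (line_max_deg G) + 2 = ennreal (real (d + 2))"
      by (simp add: d flip: ennreal_of_nat_eq_real_of_nat)
    moreover have "ennreal (max 0 C1 / c0) * ennreal (real (d + 2)) = ennreal (max 0 C1 / c0 * real (d + 2))"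
      by (rule ennreal_mult[symmetric]) (use assms(4) in auto)
    ultimately show ?thesis
      by (simp only: times_divide_eq_left)
  qed
  have K_nonneg: "0 \<le> max 0 C1 * real (d + 2) / c0"
    using assms(4) by simp
  have "operator_norm G (ewt G) (cochains_c G) (Laplace1 G) \<le> ennreal (max 0 C1 * real (d + 2) / c0)"
    using L.cochains_c_subset_l2[OF L.edge_weight_ewt]
    by (intro operator_norm_le Laplace1_l2 Laplace1_bound K_nonneg) auto
  moreover have "operator_norm G (\<lambda>_ _. 1) (l2 G (\<lambda>_ _. 1)) (normalized_Laplace1 G)
      \<le> ennreal (max 0 C1 * real (d + 2) / c0)"
    by (intro operator_norm_le normalized_Laplace1_bound K_nonneg)
  moreover have "\<forall>f\<in>l2 G (ewt G). B f = Laplace1 G f"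
    if "bounded_operator G (ewt G) B" "\<forall>f\<in>cochains_c G. B f = Laplace1 G f" for B
    using L.bounded_operator_unique[OF L.edge_weight_ewt that(1) Laplace1_bounded_operator] that(2) by blast
  ultimately show ?thesis
    unfolding K using Laplace1_bounded_operator Laplace1_self_adjoint by blast
qed

end
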